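(* Let $n\ge 2$, let $G$ be a (not necessarily commutative) group of order $4n^2$, written additively, and let $D\subseteq G$ be a Hadamard difference set, i.e. a $(4n^2,2n^2-n,n^2-n)$ difference set in $G$. Then $D^2\cup(\overline{D})^{2}\subseteq G^2$ is a difference set of propriety $3$ with parameters $$\big(4n^2,\ 2n^2(4n^2+1),\ 2n^2(2n^2+1)\big).$$ Moreover, $D^{2-}\cup(\overline{D})^{2-}$ and $(D\times\overline{D})\cup(\overline{D}\times D)$ are difference sets of propriety $3$ with parameters $$\big(4n^2,\ 2n^2(4n^2-1),\ 2n^2(2n^2-1)\big).$$
   Context: A $(v,k,\lambda)$ difference set in a group $G$ of order $v$ is a subset $D\subseteq G$ with $|D|=k$ such that for every $g\in G\setminus\{0\}$ there are exactly $\lambda$ choices of $x,x'\in D$ with $x-x'=g$. Notation: $\overline{D}=G\setminus D$, and for $E\subseteq G$, $E^2=E\times E$ and $E^{2-}=(E\times E)\setminus\{(x,x)\mid x\in E\}$. A set $P\subseteq G^2$ with $|P|=K$ is a $(v,K,\Lambda)$ difference set of propriety $3$ if for every $g\in G\setminus\{0\}$: 1. there are exactly $\Lambda$ choices of $(x,y),(x',y')\in P$ with $-x+x'=-y+y'=g$; 2. there are exactly $\Lambda$ choices of $(x,y),(x',y')\in P$ with $x-x'=g$ and $y=y'$; 3. there are exactly $\Lambda$ choices of $(x,y),(x',y')\in P$ with $x=x'$ and $y-y'=g$. *)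

theory Defs
  imports "HOL-Library.Cardinality"
begin

text \<open>
  Class \<open>group_add\<close> is that of additively written, not necessarily commutative groups; the ambient
  group \<open>G\<close> is the whole type \<open>'a\<close>. The number of choices of elements is the cardinality of
  the set of ordered tuples.
\<close>

definition difference_set :: "nat \<Rightarrow> nat \<Rightarrow> nat \<Rightarrow> 'a::{group_add,finite} set \<Rightarrow> bool" where
  "difference_set v k l D \<longleftrightarrow>
     CARD('a) = v \<and> card D = k \<and>
     (\<forall>g. g \<noteq> 0 \<longrightarrow> card {(x, x'). x \<in> D \<and> x' \<in> D \<and> x - x' = g} = l)"

definition hadamard_difference_set :: "nat \<Rightarrow> 'a::{group_add,finite} set \<Rightarrow> bool" where
  "hadamard_difference_set n D \<longleftrightarrow> difference_set (4 * n^2) (2 * n^2 - n) (n^2 - n) D"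

definition difference_set_propriety3 ::
    "nat \<Rightarrow> nat \<Rightarrow> nat \<Rightarrow> ('a::{group_add,finite} \<times> 'a) set \<Rightarrow> bool" where
  "difference_set_propriety3 v K L P \<longleftrightarrow>
     CARD('a) = v \<and> card P = K \<and>
     (\<forall>g. g \<noteq> 0 \<longrightarrow>
        card {((x, y), (x', y')). (x, y) \<in> P \<and> (x', y') \<in> P \<and> - x + x' = g \<and> - y + y' = g} = L \<and>
        card {((x, y), (x', y')). (x, y) \<in> P \<and> (x', y') \<in> P \<and> x - x' = g \<and> y = y'} = L \<and>
        card {((x, y), (x', y')). (x, y) \<in> P \<and> (x', y') \<in> P \<and> x = x' \<and> y - y' = g} = L)"

definition offdiag_square :: "'a set \<Rightarrow> ('a \<times> 'a) set" where
  "offdiag_square E = (E \<times> E) - {(x, x) | x. x \<in> E}"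

end

theory Submission
  imports Defs "HOL-Analysis.Cartesian_Space"
begin

text \<open>
  Let \<open>s\<close> be the function with value \<open>1\<close> on \<open>D\<close> and \<open>-1\<close> off \<open>D\<close>, and let \<open>v = 4n\<^sup>2\<close>. The parameters of
  \<open>D\<close> say that \<open>(\<Sum>s)\<^sup>2 = v\<close> and that \<open>\<Sum>\<^sub>x s(g + x) s(x) = 0\<close> for \<open>g \<noteq> 0\<close>. The latter means that the
  matrix \<open>(s(a + b))\<close> is a Hadamard matrix; as its transpose is then one too, also
  \<open>\<Sum>\<^sub>x s(x + g) s(x) = 0\<close>. The three sets have indicators of the form
  \<open>(1 + \<epsilon> s(x) s(y)) / 2 - c [x = y]\<close>, with \<open>(\<epsilon>, c)\<close> equal to \<open>(1, 0)\<close>, \<open>(1, 1)\<close> and \<open>(-1, 0)\<close>,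
  so all the required counts follow by expanding products.
\<close>

text \<open>Each difference condition determines the first member \<open>p\<close> of a pair from
  the second by a translation \<open>h\<close>, so counting the pairs becomes a correlation sum of
  indicators over \<open>q\<close>.\<close>

lemma card_graph_pairs:
  fixes P :: "'b::finite set"
  shows "real (card {(p, q). p \<in> P \<and> q \<in> P \<and> p = h q}) =
    (\<Sum>q\<in>UNIV. of_bool (h q \<in> P) * of_bool (q \<in> P))"
proof -
  have "{(p, q). p \<in> P \<and> q \<in> P \<and> p = h q} = (\<lambda>q. (h q, q)) ` {q. h q \<in> P \<and> q \<in> P}"
    by auto
  then have "card {(p, q). p \<in> P \<and> q \<in> P \<and> p = h q} = card {q. h q \<in> P \<and> q \<in> P}"
    by (simp add: card_image inj_on_def)
  also have "real \<dots> = (\<Sum>q\<in>UNIV. of_bool (h q \<in> P \<and> q \<in> P))"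
    by (simp add: sum_of_bool_eq)
  finally show ?thesis
    by (simp only: of_bool_conj)
qed

lemma sum_left_translate:
  fixes f :: "'a::{group_add,finite} \<Rightarrow> 'b::comm_monoid_add"
  shows "(\<Sum>x\<in>UNIV. f (g + x)) = sum f UNIV"
  by (rule sum.reindex_bij_witness[of _ "\<lambda>x. - g + x" "\<lambda>x. g + x"]) (simp_all add: add.assoc[symmetric])

lemma sum_right_translate:
  fixes f :: "'a::{group_add,finite} \<Rightarrow> 'b::comm_monoid_add"
  shows "(\<Sum>x\<in>UNIV. f (x + g)) = sum f UNIV"
  by (rule sum.reindex_bij_witness[of _ "\<lambda>x. x + - g" "\<lambda>x. x + g"]) (simp_all add: add.assoc)

text \<open>A difference set controls left translates \<open>g + x\<close>, but the condition on
  \<open>- x + x'\<close> involves right translates, which need not agree with them in a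
  non-commutative group. The bridge is that a one-sided inverse of a square matrix is
  two-sided.\<close>

lemma right_autocorrelation_zero:
  fixes s :: "'a::{group_add,finite} \<Rightarrow> real"
  assumes sq: "\<And>x. s x * s x = 1"
    and left: "\<And>g. g \<noteq> 0 \<Longrightarrow> (\<Sum>x\<in>UNIV. s (g + x) * s x) = 0"
    and "g \<noteq> 0"
  shows "(\<Sum>x\<in>UNIV. s (x + g) * s x) = 0"
proof -
  define v where "v = real CARD('a)"
  have v: "v \<noteq> 0"
    by (simp add: v_def)
  define A :: "((real, 'a) vec, 'a) vec" where "A = (\<chi> a b. s (a + b))"
  \<comment> \<open>The transpose of \<open>A\<close> divided by \<open>v\<close>: the inverse of
    \<open>A\<close> once its rows are orthogonal.\<close>
  define B :: "((real, 'a) vec, 'a) vec" where "B = (\<chi> b a. s (a + b) / v)"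
  have rows: "(\<Sum>b\<in>UNIV. s (a + b) * s (a' + b)) = (if a = a' then v else 0)" for a a'
  proof -
    have "(\<Sum>b\<in>UNIV. s (a + b) * s (a' + b)) = (\<Sum>b\<in>UNIV. s ((a - a') + (a' + b)) * s (a' + b))"
      by (simp add: add.assoc[symmetric])
    also have "\<dots> = (\<Sum>c\<in>UNIV. s ((a - a') + c) * s c)"
      by (rule sum_left_translate)
    finally show ?thesis
      using left[of "a - a'"] by (simp add: sq v_def)
  qed
  have "A ** B = mat 1"
    using rows v by (simp add: A_def B_def matrix_matrix_mult_def mat_def vec_eq_iff
        flip: sum_divide_distrib)
  then have "B ** A = mat 1"
    by (simp add: matrix_left_right_inverse)
  \<comment> \<open>Up to the factor \<open>v\<close>, this entry is the inner product of columns
    \<open>g\<close> and \<open>0\<close> of \<open>A\<close>, which is the right autocorrelation at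
    \<open>g\<close>.\<close>
  then have "(B ** A) $ g $ 0 = (mat 1 :: ((real, 'a) vec, 'a) vec) $ g $ 0"
    by simp
  then show ?thesis
    using v \<open>g \<noteq> 0\<close> by (simp add: A_def B_def matrix_matrix_mult_def mat_def flip: sum_divide_distrib)
qed

text \<open>Treats the three sets at once. The equations \<open>ec\<close> leave exactly the pairs
  (1, 0), (1, 1), (-1, 0) for (\<open>e\<close>, \<open>c\<close>): the diagonal can be removed only
  where the indicator \<open>(1 + e) / 2\<close> on it is 1.\<close>

lemma propriety3_of_sign_function:
  fixes s :: "'a::{group_add,finite} \<Rightarrow> real" and P :: "('a \<times> 'a) set" and e c :: real
  assumes sq: "\<And>x. s x * s x = 1"
    and total: "(\<Sum>x\<in>UNIV. s x) * (\<Sum>x\<in>UNIV. s x) = real CARD('a)"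
    and left: "\<And>g. g \<noteq> 0 \<Longrightarrow> (\<Sum>x\<in>UNIV. s (g + x) * s x) = 0"
    and ec: "e * e = 1" "c * c = c" "c * e = c"
    and P: "\<And>x y. of_bool ((x, y) \<in> P) = (1 + e * (s x * s y)) / 2 - c * of_bool (x = y)"
    and v: "CARD('a) = v"
    and K: "real K = (real v)\<^sup>2 / 2 + e * real v / 2 - c * real v"
    and L: "real L = (real v)\<^sup>2 / 4 + e * real v / 2 - c * real v"
  shows "difference_set_propriety3 v K L P"
proof -
  define S where "S = (\<Sum>x\<in>UNIV. s x)"
  have SS: "S * S = real v"
    using total v by (simp add: S_def)
  have right: "(\<Sum>x\<in>UNIV. s (x + g) * s x) = 0" if "g \<noteq> 0" for g
    using right_autocorrelation_zero[OF sq left that] .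
  define a where "a x y = (1 + e * (s x * s y)) / 2" for x y
  define w where "w x y = a x y - c * of_bool (x = y)" for x y
  have Pw: "of_bool ((x, y) \<in> P) = w x y" for x y
    by (simp add: P w_def a_def)
  have ca: "c * a x x = c" for x
    using ec by (simp add: a_def sq algebra_simps)
  have sum_pairs: "sum f UNIV = (\<Sum>x\<in>UNIV. \<Sum>y\<in>UNIV. f (x, y))" for f :: "'a \<times> 'a \<Rightarrow> real"
    by (simp add: sum.cartesian_product)
  have "real (card P) = (\<Sum>p\<in>UNIV. of_bool (p \<in> P))"
    by (simp add: sum_of_bool_eq)
  also have "\<dots> = (\<Sum>x\<in>UNIV. \<Sum>y\<in>UNIV. w x y)"
    unfolding sum_pairs by (simp only: Pw)
  also have "\<dots> = (\<Sum>x\<in>UNIV. \<Sum>y\<in>UNIV. 1 / 2 + e / 2 * (s x * s y)) - c * (\<Sum>x\<in>(UNIV :: 'a set). \<Sum>y\<in>UNIV. of_bool (x = y))"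
    by (simp add: w_def a_def sum_subtractf add_divide_distrib sum_distrib_left)
  also have "\<dots> = real K"
    unfolding K
    by (simp add: sum.distrib v SS S_def[symmetric] power2_eq_square
        flip: sum_distrib_left sum_distrib_right sum_divide_distrib)
  finally have card: "card P = K"
    by simp
  have pairs: "real (card {(p, q). p \<in> P \<and> q \<in> P \<and> p = (h1 (fst q), h2 (snd q))}) =
      (\<Sum>x\<in>UNIV. \<Sum>y\<in>UNIV. w (h1 x) (h2 y) * w x y)" for h1 h2
    unfolding card_graph_pairs sum_pairs by (simp only: Pw fst_conv snd_conv)
  \<comment> \<open>The double sums factor: both terms linear in \<open>e\<close> give
    \<open>e / 4 * (S * S)\<close>, and the last is a product of two autocorrelations. Only their
    product is assumed zero, since for a translation of one coordinate the other factor is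
    \<open>v\<close>.\<close>
  have main: "(\<Sum>x\<in>UNIV. \<Sum>y\<in>UNIV. a (h1 x) (h2 y) * a x y) = (real v)\<^sup>2 / 4 + e * real v / 2"
    if "(\<Sum>x\<in>UNIV. s (h1 x)) = S" "(\<Sum>x\<in>UNIV. s (h2 x)) = S"
      "(\<Sum>x\<in>UNIV. s (h1 x) * s x) * (\<Sum>x\<in>UNIV. s (h2 x) * s x) = 0" for h1 h2
  proof -
    have "a (h1 x) (h2 y) * a x y = 1 / 4 + e / 4 * (s (h1 x) * s (h2 y)) + e / 4 * (s x * s y)
        + 1 / 4 * ((s (h1 x) * s x) * (s (h2 y) * s y))" for x y
    proof -
      have "a (h1 x) (h2 y) * a x y = 1 / 4 + e / 4 * (s (h1 x) * s (h2 y)) + e / 4 * (s x * s y)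
        + (e * e) / 4 * ((s (h1 x) * s x) * (s (h2 y) * s y))"
        by (simp add: a_def field_simps)
      then show ?thesis by (simp only: ec)
    qed
    then show ?thesis
      by (simp add: sum.distrib v SS S_def[symmetric] power2_eq_square that
          flip: sum_distrib_left sum_distrib_right sum_divide_distrib)
  qed
  have expand: "(\<Sum>x\<in>UNIV. \<Sum>y\<in>UNIV. w (h1 x) (h2 y) * w x y) =
      (\<Sum>x\<in>UNIV. \<Sum>y\<in>UNIV. a (h1 x) (h2 y) * a x y)
      - c * (\<Sum>x\<in>UNIV. a (h1 x) (h2 x))
      - c * (\<Sum>x\<in>UNIV. \<Sum>y\<in>UNIV. a x y * of_bool (h1 x = h2 y))
      + c * (\<Sum>x\<in>UNIV. of_bool (h1 x = h2 x))" for h1 h2 :: "'a \<Rightarrow> 'a"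
  proof -
    have "w (h1 x) (h2 y) * w x y = a (h1 x) (h2 y) * a x y
        - c * (a (h1 x) (h2 y) * of_bool (x = y)) - c * (a x y * of_bool (h1 x = h2 y))
        + c * (of_bool (h1 x = h2 x) * of_bool (x = y))" for x y
    proof -
      have "w (h1 x) (h2 y) * w x y = a (h1 x) (h2 y) * a x y
        - c * (a (h1 x) (h2 y) * of_bool (x = y)) - c * (a x y * of_bool (h1 x = h2 y))
        + (c * c) * (of_bool (h1 x = h2 x) * of_bool (x = y))"
        unfolding w_def by (cases "x = y") (simp_all add: algebra_simps)
      then show ?thesis by (simp only: ec)
    qed
    then show ?thesis
      by (simp add: sum.distrib sum_subtractf flip: sum_distrib_left)
  qed
  \<comment> \<open>A common translation preserves the diagonal, so the three corrections in
    \<open>expand\<close> are \<open>- c * v\<close>, \<open>- c * v\<close> and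
    \<open>+ c * v\<close>.\<close>
  have diag: "(\<Sum>x\<in>UNIV. \<Sum>y\<in>UNIV. w (x + g) (y + g) * w x y) = real L" if "g \<noteq> 0" for g
    unfolding expand
    using main[of "\<lambda>x. x + g" "\<lambda>x. x + g"] right[OF that]
    by (simp add: sum_right_translate[of s] sum_right_translate[of "\<lambda>x. a x x"] S_def L v
        sum_distrib_left ca)
  \<comment> \<open>Translating one coordinate makes the diagonal disjoint from its image: the
    overlap term vanishes and the other two corrections are \<open>- c * v / 2\<close> each, again
    \<open>- c * v\<close> in total.\<close>
  have half: "c * (\<Sum>x\<in>UNIV. a (g + x) x) = c * real v / 2" if "g \<noteq> 0" for g
  proof -
    have "(\<Sum>x\<in>UNIV. a (g + x) x) = (\<Sum>x\<in>UNIV. 1 / 2 + e / 2 * (s (g + x) * s x))"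
      by (simp add: a_def add_divide_distrib)
    also have "\<dots> = real v / 2"
      by (simp add: sum.distrib v left[OF that]
          flip: sum_distrib_left sum_divide_distrib)
    finally show ?thesis by simp
  qed
  have a_sym: "a x y = a y x" for x y
    by (simp add: a_def mult.commute)
  have w_sym: "w x y = w y x" for x y
    by (simp add: w_def a_sym[of x y] eq_commute[of x y])
  have horizontal: "(\<Sum>x\<in>UNIV. \<Sum>y\<in>UNIV. w (g + x) y * w x y) = real L" if "g \<noteq> 0" for g
  proof -
    have "(\<Sum>x\<in>UNIV. \<Sum>y\<in>UNIV. a x y * of_bool (g + x = y)) = (\<Sum>x\<in>UNIV. a (g + x) x)"
      by (intro sum.cong refl) (simp, rule a_sym)
    moreover have "(\<Sum>x\<in>UNIV. \<Sum>y\<in>UNIV. a (g + x) y * a x y) = (real v)\<^sup>2 / 4 + e * real v / 2"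
      using main[of "\<lambda>x. g + x" "\<lambda>x. x"] left[OF that]
      by (simp add: sum_left_translate[of s] flip: S_def)
    moreover have "(\<Sum>x\<in>UNIV. of_bool (g + x = x)) = (0 :: real)"
    proof -
      have "g + x \<noteq> x" for x
        using that by (metis add.left_neutral add_right_cancel)
      then show ?thesis by simp
    qed
    ultimately show ?thesis
      unfolding expand by (simp only: half[OF that] L)
  qed
  have vertical: "(\<Sum>x\<in>UNIV. \<Sum>y\<in>UNIV. w x (g + y) * w x y) = real L" if "g \<noteq> 0" for g
  proof -
    have "(\<Sum>x\<in>UNIV. \<Sum>y\<in>UNIV. w x (g + y) * w x y) = (\<Sum>x\<in>UNIV. \<Sum>y\<in>UNIV. w (g + y) x * w y x)"
      by (intro sum.cong refl arg_cong2[where f = "(*)"] w_sym)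
    also have "\<dots> = (\<Sum>y\<in>UNIV. \<Sum>x\<in>UNIV. w (g + y) x * w y x)"
      by (rule sum.swap)
    finally show ?thesis
      using horizontal[OF that] by simp
  qed
  have "card {((x, y), (x', y')). (x, y) \<in> P \<and> (x', y') \<in> P \<and> - x + x' = g \<and> - y + y' = g} = L"
    if "g \<noteq> 0" for g
  proof -
    \<comment> \<open>So the first condition is a right translation by \<open>- g\<close> in both
      coordinates, and \<open>diag\<close> is used at \<open>- g\<close>.\<close>
    have eq: "- u + u' = g \<longleftrightarrow> u = u' - g" for u u'
    proof
      assume g: "- u + u' = g"
      have "u' = u + g"
        unfolding g[symmetric] by (simp add: add.assoc[symmetric])
      then show "u = u' - g"
        by simp
    next
      assume u: "u = u' - g"
      have "u' = u + g"
        by (simp add: u)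
      then show "- u + u' = g"
        by (simp add: add.assoc[symmetric])
    qed
    have "{((x, y), (x', y')). (x, y) \<in> P \<and> (x', y') \<in> P \<and> - x + x' = g \<and> - y + y' = g} =
        {(p, q). p \<in> P \<and> q \<in> P \<and> p = (fst q + - g, snd q + - g)}"
      by (auto simp: eq)
    then show ?thesis
      using pairs[of "\<lambda>x. x + - g" "\<lambda>x. x + - g"] diag[of "- g"] that by simp
  qed
  moreover have "card {((x, y), (x', y')). (x, y) \<in> P \<and> (x', y') \<in> P \<and> x - x' = g \<and> y = y'} = L"
    if "g \<noteq> 0" for g
  proof -
    have "{((x, y), (x', y')). (x, y) \<in> P \<and> (x', y') \<in> P \<and> x - x' = g \<and> y = y'} =
        {(p, q). p \<in> P \<and> q \<in> P \<and> p = (g + fst q, snd q)}"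
      by (auto simp: diff_eq_eq)
    then show ?thesis
      using pairs[of "\<lambda>x. g + x" "\<lambda>x. x"] horizontal[OF that] by simp
  qed
  moreover have "card {((x, y), (x', y')). (x, y) \<in> P \<and> (x', y') \<in> P \<and> x = x' \<and> y - y' = g} = L"
    if "g \<noteq> 0" for g
  proof -
    have "{((x, y), (x', y')). (x, y) \<in> P \<and> (x', y') \<in> P \<and> x = x' \<and> y - y' = g} =
        {(p, q). p \<in> P \<and> q \<in> P \<and> p = (fst q, g + snd q)}"
      by (auto simp: diff_eq_eq)
    then show ?thesis
      using pairs[of "\<lambda>x. x" "\<lambda>x. g + x"] vertical[OF that] by simp
  qed
  ultimately show ?thesis
    using v card by (simp add: difference_set_propriety3_def)
qed

theorem theorem3p14:
  fixes n :: nat and D :: "'a::{group_add,finite} set"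
  assumes "n \<ge> 2"
    and "CARD('a) = 4 * n^2"
    and "hadamard_difference_set n D"
  shows "difference_set_propriety3 (4 * n^2) (2 * n^2 * (4 * n^2 + 1)) (2 * n^2 * (2 * n^2 + 1))
           ((D \<times> D) \<union> ((UNIV - D) \<times> (UNIV - D)))
       \<and> difference_set_propriety3 (4 * n^2) (2 * n^2 * (4 * n^2 - 1)) (2 * n^2 * (2 * n^2 - 1))
           (offdiag_square D \<union> offdiag_square (UNIV - D))
       \<and> difference_set_propriety3 (4 * n^2) (2 * n^2 * (4 * n^2 - 1)) (2 * n^2 * (2 * n^2 - 1))
           ((D \<times> (UNIV - D)) \<union> ((UNIV - D) \<times> D))"
proof -
  define s :: "'a \<Rightarrow> real" where "s x = (if x \<in> D then 1 else - 1)" for x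
  have D: "card D = 2 * n\<^sup>2 - n"
    and pairs: "\<And>g. g \<noteq> 0 \<Longrightarrow> card {(x, x'). x \<in> D \<and> x' \<in> D \<and> x - x' = g} = n\<^sup>2 - n"
    using assms(3) by (simp_all add: hadamard_difference_set_def difference_set_def)
  \<comment> \<open>These keep the natural-number subtractions in the parameters from
    truncating.\<close>
  have n: "n \<le> n\<^sup>2" "1 \<le> n\<^sup>2"
    using assms(1) by (simp_all add: power2_eq_square)
  have minus_one: "real (4 * n\<^sup>2 - 1) = 4 * (real n)\<^sup>2 - 1" "real (2 * n\<^sup>2 - 1) = 2 * (real n)\<^sup>2 - 1"
    using n by (simp_all add: of_nat_diff)
  have v: "real CARD('a) = 4 * (real n)\<^sup>2"
    using assms(2) by simp
  have ind: "of_bool (x \<in> D) = (1 + s x) / 2" for x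
    by (simp add: s_def)
  have sq: "s x * s x = 1" for x
    by (simp add: s_def)
  have "real (card D) = (\<Sum>x\<in>UNIV. of_bool (x \<in> D))"
    by (simp add: sum_of_bool_eq)
  also have "\<dots> = (real CARD('a) + (\<Sum>x\<in>UNIV. s x)) / 2"
    by (simp only: ind) (simp add: sum.distrib flip: sum_divide_distrib)
  \<comment> \<open>The sum is \<open>2 * card D - v\<close> with
    \<open>v = 4 * n^2\<close>.\<close>
  finally have S: "(\<Sum>x\<in>UNIV. s x) = - 2 * real n"
    using D n v by (simp add: of_nat_diff)
  have left: "(\<Sum>x\<in>UNIV. s (g + x) * s x) = 0" if "g \<noteq> 0" for g
  proof -
    have "{(x, x'). x \<in> D \<and> x' \<in> D \<and> x - x' = g} = {(x, x'). x \<in> D \<and> x' \<in> D \<and> x = g + x'}"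
      by (auto simp: diff_eq_eq)
    then have "real (n\<^sup>2 - n) = (\<Sum>x\<in>UNIV. of_bool (g + x \<in> D) * of_bool (x \<in> D))"
      using pairs[OF that] card_graph_pairs[of D "\<lambda>x. g + x"] by simp
    also have "\<dots> = (\<Sum>x\<in>UNIV. (1 + s (g + x) + s x + s (g + x) * s x) / 4)"
      by (simp only: ind) (simp add: field_simps)
    \<comment> \<open>The first two terms already give \<open>(4 * n^2 - 4 * n) / 4\<close>, the
      prescribed count, so the autocorrelation must be zero.\<close>
    also have "\<dots> = (real CARD('a) + 2 * (\<Sum>x\<in>UNIV. s x) + (\<Sum>x\<in>UNIV. s (g + x) * s x)) / 4"
      by (simp add: sum.distrib sum_left_translate[of s] flip: sum_divide_distrib)
    finally show ?thesis
      using n v S by (simp add: of_nat_diff)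
  qed
  have total: "(\<Sum>x\<in>UNIV. s x) * (\<Sum>x\<in>UNIV. s x) = real CARD('a)"
    by (simp add: S v power2_eq_square)
  note rule = propriety3_of_sign_function[OF sq total left _ _ _ _ assms(2)]
  have "difference_set_propriety3 (4 * n^2) (2 * n^2 * (4 * n^2 + 1)) (2 * n^2 * (2 * n^2 + 1))
           ((D \<times> D) \<union> ((UNIV - D) \<times> (UNIV - D)))"
    by (rule rule[of 1 0]) (auto simp: s_def power2_eq_square algebra_simps)
  \<comment> \<open>The parameters agree with those of the next set because \<open>e / 2 - c\<close>
    is -1/2 for both (1, 1) and (-1, 0).\<close>
  moreover have "difference_set_propriety3 (4 * n^2) (2 * n^2 * (4 * n^2 - 1)) (2 * n^2 * (2 * n^2 - 1))
           (offdiag_square D \<union> offdiag_square (UNIV - D))"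
    by (rule rule[of 1 1], simp_all only: of_nat_mult minus_one)
      (auto simp: s_def offdiag_square_def power2_eq_square algebra_simps)
  moreover have "difference_set_propriety3 (4 * n^2) (2 * n^2 * (4 * n^2 - 1)) (2 * n^2 * (2 * n^2 - 1))
           ((D \<times> (UNIV - D)) \<union> ((UNIV - D) \<times> D))"
    by (rule rule[of "- 1" 0], simp_all only: of_nat_mult minus_one)
      (auto simp: s_def power2_eq_square algebra_simps)
  ultimately show ?thesis
    by blast
qed

end
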